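(* Let $p\in \mathbb{R}[x]$ be a polynomial and let $f\colon \mathbb{N}_0\to\mathbb{Z}$ be given by $f(n)=\lfloor p(n)\rfloor$. Then $f$ is regular (i.e., $k$-regular for some integer $k\ge 2$) if and only if all the coefficients of $p$, except possibly for the constant term, are rational.
   Context: For an integer $k\ge 2$, the $k$-kernel of a sequence $(a_n)_{n\ge0}$ is the set of subsequences $\{(a_{k^l n+r})_{n\ge 0} : l\ge 0,\ 0\le r<k^l\}$. An integer sequence $(a_n)_{n\ge 0}$ is $k$-regular if its $k$-kernel spans a finitely generated abelian subgroup of $\mathbb{Z}^{\mathbb{N}_0}$. Here $\mathbb{N}_0=\{0,1,2,\dots\}$. *)

theory Defs
  imports
    Complex_Main
    "HOL-Library.Function_Algebras"
    "HOL-Computational_Algebra.Polynomial"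
    "HOL-Computational_Algebra.Group_Closure"
begin

definition k_kernel :: "nat \<Rightarrow> (nat \<Rightarrow> 'a) \<Rightarrow> (nat \<Rightarrow> 'a) set" where
  "k_kernel k a = {(\<lambda>n. a (k ^ l * n + r)) | l r. r < k ^ l}"

definition finitely_generated :: "'a::ab_group_add set \<Rightarrow> bool" where
  "finitely_generated H \<longleftrightarrow> (\<exists>G. finite G \<and> H = group_closure G)"

(* The group structure on nat \<Rightarrow> int is the pointwise one from Function_Algebras. *)
definition k_regular :: "nat \<Rightarrow> (nat \<Rightarrow> int) \<Rightarrow> bool" where
  "k_regular k a \<longleftrightarrow> finitely_generated (group_closure (k_kernel k a))"

definition regular :: "(nat \<Rightarrow> int) \<Rightarrow> bool" where
  "regular a \<longleftrightarrow> (\<exists>k\<ge>2. k_regular k a)"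

end

theory Submission
  imports Defs
begin

text \<open>
  If \<open>D\<close> clears the denominators of the non-constant coefficients of \<open>p\<close>, then every element of the
  \<open>D\<close>-kernel other than \<open>f\<close> itself is an integer polynomial of degree at most \<open>degree p\<close>; subgroups
  of finitely generated abelian groups being finitely generated, \<open>f\<close> is \<open>D\<close>-regular.

  Conversely, a finitely generated group of sequences is finite modulo \<open>q\<close>, so \<open>f (k\<^sup>i n)\<close> and
  \<open>f (k\<^sup>j n)\<close> are congruent modulo \<open>q\<close> for some \<open>i < j\<close>. Hence the polynomial
  \<open>(p (k\<^sup>j x) - p (k\<^sup>i x)) / q\<close> differs from an integer sequence by an error \<open>e\<close> with
  \<open>\<bar>e n\<bar> < 1 / q\<close>. For \<open>q = 2 ^ (degree p + 1)\<close> the difference of order \<open>degree p + 1\<close>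
  of \<open>e\<close> is an integer of absolute value less than \<open>1\<close>, so it vanishes; being bounded, \<open>e\<close> is constant.
  A polynomial with integer values has rational coefficients.
\<close>

section \<open>Finitely generated abelian groups\<close>

lemma group_closure_least:
  fixes H :: "'a::ab_group_add set"
  assumes "S \<subseteq> H" "0 \<in> H" "\<And>x y. x \<in> H \<Longrightarrow> y \<in> H \<Longrightarrow> x - y \<in> H"
  shows "group_closure S \<subseteq> H"
proof
  fix x assume "x \<in> group_closure S"
  then show "x \<in> H" by induction (use assms in auto)
qed

lemma group_closure_of_int_mult:
  fixes s :: "'a::comm_ring_1"
  assumes "s \<in> group_closure S"
  shows "of_int c * s \<in> group_closure S"
proof (cases "c \<ge> 0")
  case True
  then show ?thesis
    using group_closure_scalar_mult_left[OF assms, of "nat c"] by simp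
next
  case False
  then have "of_int c * s = - (of_nat (nat (- c)) * s)" by simp
  then show ?thesis
    using group_closure_scalar_mult_left[OF assms, of "nat (- c)"] by simp
qed

lemma group_closure_sum_mem:
  assumes "\<And>i. i \<in> A \<Longrightarrow> h i \<in> group_closure S"
  shows "sum h A \<in> group_closure S"
  using assms by (induction A rule: infinite_finite_induct) (auto intro: group_closure_add)

lemma group_closure_insert:
  fixes g :: "'a::comm_ring_1"
  shows "group_closure (insert g G) = {of_int c * g + u | c u. u \<in> group_closure G}"
    (is "_ = ?R")
proof
  have mono: "u \<in> group_closure (insert g G)" if "u \<in> group_closure G" for u
    using group_closure_least[of G "group_closure (insert g G)"] that
    by (auto intro: group_closure.intros)
  show "?R \<subseteq> group_closure (insert g G)"
    by (auto intro!: group_closure_add group_closure_of_int_mult intro: mono group_closure.base)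
  show "group_closure (insert g G) \<subseteq> ?R"
  proof (rule group_closure_least)
    have "g = of_int 1 * g + 0" and "s = of_int 0 * g + s" for s by simp_all
    then show "insert g G \<subseteq> ?R"
      by (blast intro: group_closure.base)
    show "0 \<in> ?R" by (auto intro!: exI[of _ 0])
  next
    fix x y assume "x \<in> ?R" "y \<in> ?R"
    then obtain c u c' u' where *: "x = of_int c * g + u" "u \<in> group_closure G"
      "y = of_int c' * g + u'" "u' \<in> group_closure G" by blast
    then have "x - y = of_int (c - c') * g + (u - u')" by (simp add: algebra_simps)
    with * show "x - y \<in> ?R" by (blast intro: group_closure.diff)
  qed
qed

text \<open>Induction on the generators. The coefficients of \<open>g\<close> in elements of
  \<open>H\<close> form a subgroup \<open>I\<close> of the integers, hence a cyclic one. One element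
  \<open>h\<close> of \<open>H\<close> realising a generator of \<open>I\<close>, together with
  generators of \<open>H \<inter> group_closure G\<close>, generates \<open>H\<close>: subtracting a
  multiple of \<open>h\<close> removes the \<open>g\<close> part.\<close>

lemma finitely_generated_subgroup:
  fixes H :: "'a::comm_ring_1 set"
  assumes "finite G" "H \<subseteq> group_closure G" "0 \<in> H"
    "\<And>x y. x \<in> H \<Longrightarrow> y \<in> H \<Longrightarrow> x - y \<in> H"
  shows "finitely_generated H"
  using assms
proof (induction G arbitrary: H)
  case empty
  then have "H = group_closure {}" by auto
  then show ?case unfolding finitely_generated_def by blast
next
  case (insert g G)
  note H0 = insert.prems(2) and Hd = insert.prems(3)
  have "finitely_generated (H \<inter> group_closure G)"
    using insert.prems by (intro insert.IH) (auto intro: group_closure.diff)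
  then obtain F where F: "finite F" "H \<inter> group_closure G = group_closure F"
    unfolding finitely_generated_def by blast
  define I where "I = {c::int. \<exists>u\<in>group_closure G. of_int c * g + u \<in> H}"
  have "group_closure I \<subseteq> I"
  proof (rule group_closure_least)
    show "0 \<in> I" unfolding I_def using H0 by (auto intro!: bexI[of _ 0])
    fix a b assume "a \<in> I" "b \<in> I"
    then obtain u v where uv: "u \<in> group_closure G" "of_int a * g + u \<in> H"
      "v \<in> group_closure G" "of_int b * g + v \<in> H" unfolding I_def by blast
    have "of_int (a - b) * g + (u - v) = (of_int a * g + u) - (of_int b * g + v)"
      by (simp add: algebra_simps)
    then have "of_int (a - b) * g + (u - v) \<in> H" using Hd uv by metis
    then show "a - b \<in> I" unfolding I_def using uv by (blast intro: group_closure.diff)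
  qed simp
  then have "Gcd I \<in> I" using Gcd_in_group_closure by blast
  then obtain w where w: "w \<in> group_closure G" "of_int (Gcd I) * g + w \<in> H"
    unfolding I_def by blast
  define h where "h = of_int (Gcd I) * g + w"
  have "group_closure (insert h F) \<subseteq> H"
  proof (rule group_closure_least)
    show "insert h F \<subseteq> H" using w F by (auto simp: h_def intro: group_closure.base)
  qed (use H0 Hd in auto)
  moreover have "H \<subseteq> group_closure (insert h F)"
  proof
    fix x assume x: "x \<in> H"
    with insert.prems(1) obtain c u where cu: "x = of_int c * g + u" "u \<in> group_closure G"
      by (auto simp: group_closure_insert)
    then have "c \<in> I" unfolding I_def using x by blast
    then obtain t where t: "c = t * Gcd I" by (metis Gcd_dvd dvdE mult.commute)
    have "of_int t * h \<in> H"
      using calculation group_closure_of_int_mult[of h "insert h F" t]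
      by (auto intro: group_closure.base)
    moreover have "x - of_int t * h = u - of_int t * w"
      by (simp add: cu h_def t algebra_simps)
    moreover have "u - of_int t * w \<in> group_closure G"
      using cu w by (intro group_closure.diff group_closure_of_int_mult)
    ultimately have "x - of_int t * h \<in> H \<inter> group_closure G"
      using Hd[OF x] by (metis IntI)
    then have "x - of_int t * h \<in> group_closure F" using F by simp
    moreover have "x = of_int t * h + (x - of_int t * h)" by simp
    ultimately show "x \<in> group_closure (insert h F)"
      unfolding group_closure_insert by blast
  qed
  ultimately show ?case
    using F(1) unfolding finitely_generated_def by (intro exI[of _ "insert h F"]) auto
qed

text \<open>In the pointwise ring of sequences \<open>of_int c\<close> is a constant sequence, so
  the products \<open>of_int c * s\<close> are the integer multiples of \<open>s\<close>.\<close>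

lemma of_int_fun_apply [simp]: "of_int c x = of_int c"
  by (cases c rule: int_diff_cases) (simp del: of_int_diff add: of_int_diff)

text \<open>Modulo \<open>q\<close>, only the residue of each generator's coefficient matters, and
  there are \<open>q\<close> residues per generator.\<close>

lemma finite_group_closure_mod:
  fixes G :: "(nat \<Rightarrow> int) set"
  assumes "finite G" "q > 0"
  shows "finite ((\<lambda>s n. s n mod q) ` group_closure G)"
  using assms(1)
proof induction
  case (insert g G)
  let ?m = "\<lambda>s n. s n mod q"
  have "?m ` group_closure (insert g G)
    \<subseteq> (\<lambda>(c, v) n. (c * g n + v n) mod q) ` ({0..<q} \<times> ?m ` group_closure G)"
  proof
    fix y assume "y \<in> ?m ` group_closure (insert g G)"
    then obtain c u where cu: "u \<in> group_closure G" "y = ?m (of_int c * g + u)"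
      by (auto simp: group_closure_insert)
    then have "y = (\<lambda>(c, v) n. (c * g n + v n) mod q) (c mod q, ?m u)"
      by (simp add: fun_eq_iff) (metis mod_add_cong mod_mult_left_eq mod_mod_trivial)
    then show "y \<in> (\<lambda>(c, v) n. (c * g n + v n) mod q) ` ({0..<q} \<times> ?m ` group_closure G)"
      using cu(1) assms(2) by (intro image_eqI[where x = "(c mod q, ?m u)"]) auto
  qed
  then show ?case by (rule finite_subset) (use insert.IH in auto)
qed simp

text \<open>Pigeonhole: infinitely many indices \<open>l\<close> share finitely many residue
  sequences.\<close>

lemma ex_congruent_pair:
  fixes h :: "nat \<Rightarrow> nat \<Rightarrow> int"
  assumes "finite G" "\<And>l. h l \<in> group_closure G" "q > 0"
  shows "\<exists>i j. i < j \<and> (\<forall>n. q dvd h j n - h i n)"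
proof -
  have "finite (range (\<lambda>l n. h l n mod q))"
    by (rule finite_subset[OF _ finite_group_closure_mod[OF assms(1,3)]]) (use assms(2) in auto)
  then have "\<not> inj (\<lambda>l n. h l n mod q)"
    using finite_imageD infinite_UNIV_nat by blast
  then obtain a b where ab: "a \<noteq> b" "\<And>n. h a n mod q = h b n mod q"
    unfolding inj_def by (metis (no_types, lifting))
  \<comment> \<open>Both orders are recorded because either of \<open>a\<close>, \<open>b\<close>
    may be the smaller index.\<close>
  have "q dvd h a n - h b n" "q dvd h b n - h a n" for n
    using ab(2)[of n] by (simp_all add: mod_eq_dvd_iff[symmetric])
  then show ?thesis using ab(1) by (metis nat_neq_iff)
qed

section \<open>Integer-valued polynomials and forward differences\<close>

text \<open>Division by \<open>x - a\<close> lowers the degree, and the quotient has the rational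
  values \<open>(p n - p a) / (n - a)\<close> for \<open>n > a\<close>. This determines nothing at
  \<open>n = a\<close>, hence the movable threshold \<open>a\<close>.\<close>

lemma coeffs_rat_if_values_rat:
  fixes p :: "real poly"
  assumes "\<And>n. n \<ge> a \<Longrightarrow> poly p (real n) \<in> \<rat>"
  shows "coeff p i \<in> \<rat>"
  using assms
proof (induction "degree p" arbitrary: p a i)
  case 0
  then obtain c where "p = [:c:]" by (metis degree_0_id)
  with 0(2)[of a] show ?case by (auto simp: coeff_pCons split: nat.splits)
next
  case (Suc d)
  define r where "r = synthetic_div p (real a)"
  have p: "p = [:- real a, 1:] * r + [:poly p (real a):]"
    unfolding r_def by (rule synthetic_div_correct'[symmetric])
  have "coeff r j \<in> \<rat>" for j
  proof (rule Suc(1))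
    show "d = degree r" using Suc(2) by (simp add: r_def degree_synthetic_div)
    fix n assume n: "Suc a \<le> n"
    have "poly p (real n) = (real n - real a) * poly r (real n) + poly p (real a)"
      by (subst p) (simp add: algebra_simps)
    then have "poly r (real n) = (poly p (real n) - poly p (real a)) / (real n - real a)"
      using n by (simp add: field_simps)
    then show "poly r (real n) \<in> \<rat>" using Suc(3) n by simp
  qed
  moreover have "poly p (real a) \<in> \<rat>" using Suc(3) by simp
  ultimately show ?case
    by (subst p) (auto simp: coeff_pCons split: nat.splits)
qed

definition fdiff :: "(nat \<Rightarrow> real) \<Rightarrow> nat \<Rightarrow> real" where
  "fdiff u n = u (Suc n) - u n"

lemma fdiff_pow_diff: "(fdiff ^^ m) (\<lambda>n. u n - v n) = (\<lambda>n. (fdiff ^^ m) u n - (fdiff ^^ m) v n)"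
  by (induction m) (auto simp: fdiff_def)

lemma fdiff_pow_Ints: "(\<And>n. u n \<in> \<int>) \<Longrightarrow> (fdiff ^^ m) u n \<in> \<int>"
  by (induction m arbitrary: n) (auto simp: fdiff_def)

lemma fdiff_pow_bound:
  assumes "\<And>n. \<bar>u n\<bar> < B"
  shows "\<bar>(fdiff ^^ m) u n\<bar> < 2 ^ m * B"
proof (induction m arbitrary: n)
  case (Suc m)
  have "(fdiff ^^ Suc m) u n = (fdiff ^^ m) u (Suc n) - (fdiff ^^ m) u n"
    by (simp add: fdiff_def[of "(fdiff ^^ m) u"])
  then show ?case using Suc[of n] Suc[of "Suc n"] unfolding power_Suc by linarith
qed (use assms in simp)

lemma fdiff_pow_poly:
  assumes "degree p \<le> m"
  shows "(fdiff ^^ Suc m) (\<lambda>n. poly p (real n)) n = 0"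
  using assms
proof (induction m arbitrary: p n)
  case 0
  then obtain c where "p = [:c:]" by (metis degree_0_id le_zero_eq)
  then show ?case by (simp add: fdiff_def)
next
  case (Suc m)
  \<comment> \<open>\<open>p (x + 1)\<close> and \<open>p x\<close> have the same degree and leading
    coefficient, so the degree drops in \<open>q\<close>.\<close>
  define q where "q = pcompose p [:1, 1:] - p"
  have deg: "degree (pcompose p [:1, 1:]) = degree p" by (simp add: degree_pcompose)
  have lc: "coeff (pcompose p [:1, 1:]) (degree p) = coeff p (degree p)"
    using lead_coeff_comp[of "[:1, 1:]" p] deg by simp
  have "degree q \<le> m"
  proof (rule degree_le, intro allI impI)
    fix i assume "i > m"
    then show "coeff q i = 0"
      using Suc.prems deg lc unfolding q_def
      by (cases "i = degree p") (auto simp: coeff_eq_0)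
  qed
  moreover have "fdiff (\<lambda>n. poly p (real n)) = (\<lambda>n. poly q (real n))"
    by (auto simp: fdiff_def q_def poly_pcompose add_ac)
  ultimately show ?case using Suc.IH[of q n] by (simp add: funpow_swap1)
qed

text \<open>Such a sequence is polynomial in \<open>n\<close>, and a bounded polynomial is constant.
  The induction hypothesis, applied to \<open>fdiff u\<close>, leaves only the affine case.\<close>

lemma bounded_fdiff_pow_eq_0:
  assumes "\<And>n. \<bar>u n\<bar> < B" "\<And>n. (fdiff ^^ Suc m) u n = 0"
  shows "fdiff u n = 0"
  using assms
proof (induction m arbitrary: u B n)
  case (Suc m)
  have d: "fdiff (fdiff u) n = 0" for n
  proof (rule Suc.IH)
    show "\<bar>fdiff u n\<bar> < 2 * B" for n
      using fdiff_pow_bound[of u B 1] Suc.prems(1) by simp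
    show "(fdiff ^^ Suc m) (fdiff u) n = 0" for n
      using Suc.prems(2)[of n] by (simp add: funpow_swap1)
  qed
  have c: "fdiff u n = fdiff u 0" for n
    using d by (induction n) (auto simp: fdiff_def[of "fdiff u"])
  have lin: "u n = u 0 + real n * fdiff u 0" for n
  proof (induction n)
    case (Suc n)
    then show ?case using c[of n] by (simp add: fdiff_def algebra_simps)
  qed simp
  have "fdiff u 0 = 0"
  proof (rule ccontr)
    assume "fdiff u 0 \<noteq> 0"
    \<comment> \<open>A nonzero slope drives \<open>u n - u 0\<close> past \<open>2 * B\<close>,
      although both terms are below \<open>B\<close> in absolute value.\<close>
    then obtain n where n: "real n * \<bar>fdiff u 0\<bar> > 2 * B"
      using reals_Archimedean3 by (metis zero_less_abs_iff)
    have "\<bar>real n * fdiff u 0\<bar> < 2 * B"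
      using lin[of n] Suc.prems(1)[of n] Suc.prems(1)[of 0] by linarith
    with n show False by (simp add: abs_mult)
  qed
  with c show ?case by simp
qed simp

lemma coeffs_rat_if_near_int:
  fixes P :: "real poly" and N :: "nat \<Rightarrow> int"
  assumes "degree P \<le> d" "\<And>n. \<bar>poly P (real n) - of_int (N n)\<bar> < 1 / 2 ^ Suc d" "i \<ge> 1"
  shows "coeff P i \<in> \<rat>"
proof -
  define e where "e = (\<lambda>n. poly P (real n) - of_int (N n))"
  have "(fdiff ^^ Suc d) e n = 0" for n
  proof -
    have "(fdiff ^^ Suc d) e n = - (fdiff ^^ Suc d) (\<lambda>n. of_int (N n)) n"
      unfolding e_def fdiff_pow_diff fdiff_pow_poly[OF assms(1)] by simp
    then have "(fdiff ^^ Suc d) e n \<in> \<int>"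
      using fdiff_pow_Ints[of "\<lambda>n. of_int (N n)" "Suc d" n] by (simp del: funpow.simps)
    moreover have "\<bar>(fdiff ^^ Suc d) e n\<bar> < 1"
      using fdiff_pow_bound[of e "1 / 2 ^ Suc d" "Suc d" n] assms(2)
      by (simp add: e_def del: funpow.simps)
    ultimately show ?thesis using Ints_nonzero_abs_less1 by blast
  qed
  then have "fdiff e n = 0" for n
    using bounded_fdiff_pow_eq_0[of e "1 / 2 ^ Suc d" d] assms(2) unfolding e_def by blast
  then have "e n = e 0" for n by (induction n) (auto simp: fdiff_def)
  then have "poly (P - [:e 0:]) (real n) = of_int (N n)" for n
    by (simp add: e_def diff_eq_eq)
  \<comment> \<open>Subtracting the constant error changes only the constant coefficient, which
    \<open>i \<ge> 1\<close> excludes.\<close>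
  then have "coeff (P - [:e 0:]) i \<in> \<rat>"
    by (intro coeffs_rat_if_values_rat[of 0]) simp
  with \<open>i \<ge> 1\<close> show ?thesis by (simp add: coeff_pCons split: nat.splits)
qed

section \<open>Regularity of the floor of a polynomial\<close>

lemma coeffs_rat_if_k_regular:
  fixes p :: "real poly"
  assumes "k \<ge> 2" "k_regular k (\<lambda>n. \<lfloor>poly p (real n)\<rfloor>)" "i \<ge> 1"
  shows "coeff p i \<in> \<rat>"
proof -
  define f where "f = (\<lambda>n. \<lfloor>poly p (real n)\<rfloor>)"
  define q :: int where "q = 2 ^ Suc (degree p)"
  obtain G where G: "finite G" "group_closure (k_kernel k f) = group_closure G"
    using assms(2) unfolding k_regular_def finitely_generated_def f_def by blast
  \<comment> \<open>These are the kernel elements with \<open>r = 0\<close>.\<close>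
  have "(\<lambda>n. f (k ^ l * n)) \<in> k_kernel k f" for l
    unfolding k_kernel_def using assms(1) by (force intro: exI[of _ l] exI[of _ 0])
  then have "(\<lambda>n. f (k ^ l * n)) \<in> group_closure G" for l
    using G(2) by (metis group_closure.base insertI2)
  then obtain a b where ab: "a < b" "\<And>n. q dvd f (k ^ b * n) - f (k ^ a * n)"
    using ex_congruent_pair[OF G(1), of "\<lambda>l n. f (k ^ l * n)" q] by (auto simp: q_def)
  define P where
    "P = smult (1 / of_int q) (pcompose p [:0, real k ^ b:] - pcompose p [:0, real k ^ a:])"
  define N where "N n = (f (k ^ b * n) - f (k ^ a * n)) div q" for n
  have "coeff P i \<in> \<rat>"
  proof (rule coeffs_rat_if_near_int)
    show "degree P \<le> degree p"
      unfolding P_def using assms(1)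
      by (intro order.trans[OF degree_smult_le] degree_diff_le) (auto simp: degree_pcompose)
    fix n
    have N: "of_int q * of_int (N n) = real_of_int (f (k ^ b * n) - f (k ^ a * n))"
      unfolding N_def using ab(2)[of n] by (metis dvd_mult_div_cancel of_int_mult)
    have q: "real_of_int q > 0" by (simp add: q_def)
    have "poly P (real n) = (poly p (real (k ^ b * n)) - poly p (real (k ^ a * n))) / of_int q"
      by (simp add: P_def poly_pcompose mult_ac)
    moreover have "of_int (N n) = real_of_int (f (k ^ b * n) - f (k ^ a * n)) / of_int q"
      using N q by (simp add: field_simps)
    \<comment> \<open>Each floor is the value minus its fractional part, so only a difference of two
      fractional parts remains.\<close>
    ultimately have "poly P (real n) - of_int (N n)
      = (frac (poly p (real (k ^ b * n))) - frac (poly p (real (k ^ a * n)))) / of_int q"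
      by (simp add: f_def frac_def diff_divide_distrib)
    moreover have "\<bar>frac x - frac y\<bar> < 1" for x y :: real
      using frac_ge_0[of x] frac_lt_1[of x] frac_ge_0[of y] frac_lt_1[of y] by linarith
    ultimately have "\<bar>poly P (real n) - of_int (N n)\<bar> < 1 / of_int q"
      using q by (simp add: divide_strict_right_mono)
    then show "\<bar>poly P (real n) - of_int (N n)\<bar> < 1 / 2 ^ Suc (degree p)"
      by (simp add: q_def)
  qed fact
  \<comment> \<open>Substituting \<open>k ^ b * x\<close> multiplies coefficient \<open>i\<close> by
    \<open>(k ^ b) ^ i\<close>; \<open>c\<close> is the resulting rational factor, nonzero since
    \<open>a < b\<close> and \<open>i \<ge> 1\<close>.\<close>
  define c where "c = ((real k ^ b) ^ i - (real k ^ a) ^ i) / of_int q"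
  have "coeff P i = c * coeff p i"
    by (simp add: P_def c_def coeff_pcompose_linear algebra_simps diff_divide_distrib)
  moreover have "(real k ^ a) ^ i < (real k ^ b) ^ i"
    using ab(1) assms by (intro power_strict_mono power_strict_increasing) auto
  then have "c \<noteq> 0" by (simp add: c_def q_def)
  moreover have "c \<in> \<rat>" by (simp add: c_def)
  ultimately have "coeff p i = coeff P i / c" "c \<in> \<rat>" by auto
  with \<open>coeff P i \<in> \<rat>\<close> show ?thesis by simp
qed

text \<open>The product of the denominators serves; starting it from a number at least 2 makes
  \<open>D\<close> admissible as the base of a kernel.\<close>

lemma ex_common_denominator:
  fixes A :: "real set"
  assumes "finite A" "A \<subseteq> \<rat>"
  shows "\<exists>D\<ge>2::nat. \<forall>x\<in>A. real D * x \<in> \<int>"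
  using assms
proof induction
  case (insert x A)
  then obtain D where D: "D \<ge> 2" "\<forall>x\<in>A. real D * x \<in> \<int>" by auto
  obtain a b where ab: "b > 0" "x = of_int a / of_int b"
    using insert.prems by (auto elim: Rats_cases')
  have "real (D * nat b) * x = of_int (int D * a)" using ab by simp
  then have "real (D * nat b) * x \<in> \<int>" by (metis Ints_of_int)
  moreover have "real (D * nat b) * y = of_int b * (real D * y)" for y
    using ab by simp
  then have "\<forall>y\<in>A. real (D * nat b) * y \<in> \<int>" using D(2) by (metis Ints_mult Ints_of_int)
  moreover have "D * nat b \<ge> 2" using D(1) ab(1)
    by (metis One_nat_def Suc_leI mult_le_mono nat_mult_1_right zero_less_nat_eq)
  ultimately show ?case by blast
qed auto

text \<open>Here \<open>p = c + P / D\<close> with \<open>P\<close> integral; substituting \<open>m x + r\<close> with \<open>D dvd m\<close> multiplies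
  the non-constant coefficients of \<open>P (x + r)\<close> by multiples of \<open>D\<close>.\<close>

lemma coeff_pcompose_linear_Ints:
  fixes p :: "real poly" and D m r :: nat
  assumes "D > 0" "\<And>i. i \<ge> 1 \<Longrightarrow> real D * coeff p i \<in> \<int>" "D dvd m" "i \<ge> 1"
  shows "coeff (pcompose p [:real r, real m:]) i \<in> \<int>"
proof -
  define P where "P = smult (real D) (p - [:coeff p 0:])"
  have "coeff P j \<in> \<int>" for j
    unfolding P_def using assms(2)[of j] by (cases j) (auto simp: coeff_pCons)
  then have int: "coeff (pcompose P [:real r, 1:]) i \<in> \<int>"
    by (intro coeff_pcompose_semiring_closed) (auto simp: coeff_pCons split: nat.splits)
  obtain t where t: "m = D * t" using assms(3) by blast
  obtain i' where i': "i = Suc i'" using assms(4) by (cases i) auto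
  have "pcompose p [:real r, real m:] = pcompose (pcompose p [:real r, 1:]) [:0, real m:]"
    by (simp add: pcompose_assoc[symmetric] pcompose_pCons)
  then have "coeff (pcompose p [:real r, real m:]) i
      = real m ^ i * coeff (pcompose p [:real r, 1:]) i"
    by (simp add: coeff_pcompose_linear)
  also have "\<dots> = real t * real m ^ i' * (real D * coeff (pcompose p [:real r, 1:]) i)"
    by (simp add: i' t)
  also have "real D * coeff (pcompose p [:real r, 1:]) i = coeff (pcompose P [:real r, 1:]) i"
    by (simp add: P_def pcompose_smult pcompose_diff i')
  finally show ?thesis using int by simp
qed

lemma regular_if_coeffs_rat:
  fixes p :: "real poly"
  assumes "\<And>i. i \<ge> 1 \<Longrightarrow> coeff p i \<in> \<rat>"
  shows "regular (\<lambda>n. \<lfloor>poly p (real n)\<rfloor>)"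
proof -
  define f where "f = (\<lambda>n. \<lfloor>poly p (real n)\<rfloor>)"
  have "\<exists>D\<ge>2::nat. \<forall>x\<in>coeff p ` {1..degree p}. real D * x \<in> \<int>"
    using assms by (intro ex_common_denominator) auto
  then obtain D :: nat where D: "D \<ge> 2" "\<And>i. 1 \<le> i \<Longrightarrow> i \<le> degree p \<Longrightarrow> real D * coeff p i \<in> \<int>"
    by auto
  have D': "real D * coeff p i \<in> \<int>" if "i \<ge> 1" for i
    using D(2)[OF that] by (cases "i \<le> degree p") (auto simp: coeff_eq_0)
  define mon :: "nat \<Rightarrow> nat \<Rightarrow> int" where "mon i n = int n ^ i" for i n
  \<comment> \<open>\<open>f\<close> accounts for \<open>l = 0\<close>, where \<open>r = 0\<close>
    is forced; the monomials account for all \<open>l \<ge> 1\<close>.\<close>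
  define G where "G = insert f (mon ` {..degree p})"
  have "(\<lambda>n. f (D ^ l * n + r)) \<in> group_closure G" if "r < D ^ l" for l r
  proof (cases l)
    case 0
    then show ?thesis using that by (auto simp: G_def intro: group_closure.base)
  next
    case (Suc l')
    define s where "s = pcompose p [:real r, real (D ^ l):]"
    \<comment> \<open>For \<open>i \<ge> 1\<close> the coefficient is an integer because
      \<open>D\<close> divides \<open>D ^ l\<close>, so the floor alters only the constant
      term.\<close>
    define z where "z i = \<lfloor>coeff s i\<rfloor>" for i
    have deg: "degree s = degree p" using D(1) by (simp add: s_def degree_pcompose)
    have "coeff s i \<in> \<int>" if "i \<ge> 1" for i
      unfolding s_def using D(1) D' Suc that by (intro coeff_pcompose_linear_Ints[of D]) auto
    then have z: "coeff s i = of_int (z i)" if "i \<ge> 1" for i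
      using that by (auto simp: z_def elim!: Ints_cases)
    have "f (D ^ l * n + r) = (\<Sum>i\<le>degree p. z i * int n ^ i)" for n
    proof -
      have "poly p (real (D ^ l * n + r)) = poly s (real n)"
        by (simp add: s_def poly_pcompose algebra_simps)
      also have "\<dots> = (\<Sum>i\<le>degree p. coeff s i * real n ^ i)"
        by (simp add: poly_altdef deg)
      \<comment> \<open>Apart from \<open>coeff s 0\<close> the sum is an integer and passes through
        the floor.\<close>
      also have "\<dots> = coeff s 0 + (\<Sum>i=1..degree p. coeff s i * real n ^ i)"
        by (simp add: sum.atMost_shift sum.atLeast1_atMost_eq lessThan_Suc_atMost)
      also have "(\<Sum>i=1..degree p. coeff s i * real n ^ i)
          = of_int (\<Sum>i=1..degree p. z i * int n ^ i)"
        by (simp add: z)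
      finally have "f (D ^ l * n + r) = z 0 + (\<Sum>i=1..degree p. z i * int n ^ i)"
        by (simp add: f_def z_def del: of_int_sum)
      then show ?thesis
        by (simp add: sum.atMost_shift sum.atLeast1_atMost_eq lessThan_Suc_atMost)
    qed
    moreover have "(\<Sum>i\<in>A. of_int (z i) * mon i) n = (\<Sum>i\<in>A. z i * int n ^ i)" for A n
      by (induction A rule: infinite_finite_induct) (auto simp: mon_def)
    ultimately have "(\<lambda>n. f (D ^ l * n + r)) = (\<Sum>i\<le>degree p. of_int (z i) * mon i)"
      by (auto simp: fun_eq_iff)
    also have "\<dots> \<in> group_closure G"
      by (intro group_closure_sum_mem group_closure_of_int_mult group_closure.base)
        (auto simp: G_def)
    finally show ?thesis .
  qed
  then have "group_closure (k_kernel D f) \<subseteq> group_closure G"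
    by (intro group_closure_least) (auto simp: k_kernel_def intro: group_closure.diff)
  then have "k_regular D f"
    unfolding k_regular_def
    by (intro finitely_generated_subgroup[of G]) (auto simp: G_def intro: group_closure.diff)
  then show ?thesis unfolding regular_def f_def using D(1) by blast
qed

theorem theoremA:
  fixes p :: "real poly" and f :: "nat \<Rightarrow> int"
  assumes "\<And>n. f n = \<lfloor>poly p (real n)\<rfloor>"
  shows "regular f \<longleftrightarrow> (\<forall>i\<ge>1. coeff p i \<in> \<rat>)"
proof -
  have "f = (\<lambda>n. \<lfloor>poly p (real n)\<rfloor>)" using assms by auto
  then show ?thesis
    using regular_if_coeffs_rat[of p] coeffs_rat_if_k_regular[of _ p]
    unfolding regular_def by blast
qed

end
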